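(* Let $\beta:\mathbb{P}^1\to\mathbb{P}^1$ be the quadratic rational map of the Riemann sphere given by $$\beta(t)=\frac{44t^2-76t+27}{56t^2-120t+62}.$$ Then the Julia set $J(\beta)$ is a Cantor set contained in $\mathbb{R}$.
   Context: The Riemann sphere is $\mathbb{P}^1=\mathbb{C}\cup\{\infty\}$. The Julia set of a rational map is the complement of its Fatou set (the largest open set on which the iterates form a normal family). A Cantor set is a nonempty compact, perfect, totally disconnected metrizable space. *)

theory Defs
  imports
    "HOL-Analysis.Analysis"
    "HOL-Computational_Algebra.Polynomial"
    "HOL-Library.Diagonal_Subsequence"
begin

datatype riemann_sphere = Fin complex | Infty

text \<open>
  The sphere carries the chordal metric, pulled back along stereographic projection onto the
  unit sphere of \<open>complex \<times> real\<close>, with \<open>Infty\<close> as the north pole.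
\<close>

fun stereo :: "riemann_sphere \<Rightarrow> complex \<times> real" where
  "stereo (Fin z) = ((2 / (1 + (cmod z)\<^sup>2)) *\<^sub>R z, ((cmod z)\<^sup>2 - 1) / (1 + (cmod z)\<^sup>2))"
| "stereo Infty = (0, 1)"

lemma one_plus_sq_pos: "0 < 1 + (cmod z)\<^sup>2"
  by (simp add: add_pos_nonneg)

lemma stereo_Fin_height: "snd (stereo (Fin z)) = 1 - 2 / (1 + (cmod z)\<^sup>2)"
  using one_plus_sq_pos[of z] by (simp add: field_simps)

lemma inj_stereo: "inj stereo"
proof (rule injI)
  fix x y assume eq: "stereo x = stereo y"
  show "x = y"
  proof (cases x; cases y)
    fix z w assume xy: "x = Fin z" "y = Fin w"
    have *: "2 / (1 + (cmod z)\<^sup>2) = 2 / (1 + (cmod w)\<^sup>2)"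
      using arg_cong[OF eq, of snd] unfolding xy stereo_Fin_height by simp
    have "(2 / (1 + (cmod z)\<^sup>2)) *\<^sub>R z = (2 / (1 + (cmod z)\<^sup>2)) *\<^sub>R w"
      using arg_cong[OF eq, of fst] unfolding xy by (simp add: *)
    then show ?thesis
      using one_plus_sq_pos[of z] xy by simp
  next
    fix z assume xy: "x = Fin z" "y = Infty"
    show ?thesis
      using arg_cong[OF eq, of snd] one_plus_sq_pos[of z] unfolding xy stereo_Fin_height by simp
  next
    fix z assume xy: "x = Infty" "y = Fin z"
    show ?thesis
      using arg_cong[OF eq, of snd] one_plus_sq_pos[of z] unfolding xy stereo_Fin_height by simp
  qed simp
qed

instantiation riemann_sphere :: metric_space
begin

definition dist_riemann_sphere :: "riemann_sphere \<Rightarrow> riemann_sphere \<Rightarrow> real" where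
  "dist_riemann_sphere x y = dist (stereo x) (stereo y)"

definition uniformity_riemann_sphere :: "(riemann_sphere \<times> riemann_sphere) filter" where
  "uniformity_riemann_sphere = (INF e\<in>{0 <..}. principal {(x, y). dist x y < e})"

definition open_riemann_sphere :: "riemann_sphere set \<Rightarrow> bool" where
  "open_riemann_sphere U \<longleftrightarrow> (\<forall>x\<in>U. eventually (\<lambda>(x', y). x' = x \<longrightarrow> y \<in> U) uniformity)"

instance
proof
  fix x y z :: riemann_sphere
  show "dist x y = 0 \<longleftrightarrow> x = y"
    by (simp add: dist_riemann_sphere_def inj_eq[OF inj_stereo])
  show "dist x y \<le> dist x z + dist y z"
    unfolding dist_riemann_sphere_def by (rule dist_triangle2)
qed (simp_all add: uniformity_riemann_sphere_def open_riemann_sphere_def)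

end

lemma range_stereo: "range stereo = sphere 0 1"
proof (intro equalityI subsetI)
  fix p assume "p \<in> range stereo"
  then obtain x where p: "p = stereo x" by auto
  show "p \<in> sphere 0 1"
  proof (cases x)
    case (Fin z)
    define s where "s = (cmod z)\<^sup>2"
    have s: "1 + s > 0" using one_plus_sq_pos[of z] by (simp add: s_def)
    have "(norm p)\<^sup>2 = (2 / (1 + s))\<^sup>2 * s + ((s - 1) / (1 + s))\<^sup>2"
      by (simp add: p Fin norm_Pair power_mult_distrib power_divide s_def)
    also have "\<dots> = ((1 + s) / (1 + s))\<^sup>2"
      unfolding power_divide by (simp add: power2_eq_square add_divide_distrib[symmetric] algebra_simps)
    also have "\<dots> = 1" using s by simp
    finally have "norm p = 1"
      by (metis norm_ge_zero one_power2 power2_eq_imp_eq zero_le_one)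
    then show ?thesis by simp
  qed (simp add: p norm_Pair)
next
  fix p :: "complex \<times> real" assume "p \<in> sphere 0 1"
  then obtain w t where p: "p = (w, t)" and "norm (w, t) = 1" by (cases p) auto
  then have eq: "(cmod w)\<^sup>2 + t\<^sup>2 = 1" by (simp add: norm_Pair)
  show "p \<in> range stereo"
  proof (cases "t = 1")
    case True
    then have "p = stereo Infty" using eq p by simp
    then show ?thesis by blast
  next
    case False
    define z where "z = (1 / (1 - t)) *\<^sub>R w"
    have "(cmod z)\<^sup>2 = (1 - t\<^sup>2) / (1 - t)\<^sup>2"
      using eq by (simp add: z_def power_divide)
    also have "\<dots> = (1 + t) / (1 - t)"
      using False by (simp add: power2_eq_square divide_simps) (simp add: algebra_simps)
    finally have z: "(cmod z)\<^sup>2 = (1 + t) / (1 - t)" .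
    have z1: "1 + (cmod z)\<^sup>2 = 2 / (1 - t)"
      unfolding z using False by (simp add: field_simps)
    have z2: "(cmod z)\<^sup>2 - 1 = 2 * t / (1 - t)"
      unfolding z using False by (simp add: field_simps)
    have "stereo (Fin z) = p"
      unfolding stereo.simps z1 z2 p using False by (simp add: z_def)
    then show ?thesis by blast
  qed
qed

lemma continuous_on_stereo: "continuous_on S stereo"
  unfolding continuous_on_iff dist_riemann_sphere_def by blast

lemma compact_UNIV_riemann_sphere: "compact (UNIV :: riemann_sphere set)"
proof -
  have "continuous_on (range stereo) (inv stereo)"
    unfolding continuous_on_iff dist_riemann_sphere_def
    by (metis f_inv_into_f)
  moreover have "compact (range stereo)"
    by (simp add: range_stereo)
  ultimately have "compact (inv stereo ` range stereo)"
    by (rule compact_continuous_image)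
  then show ?thesis
    by (simp add: inj_stereo)
qed

text \<open>
  For coprime \<open>p\<close> and \<open>q\<close> this is the self-map of the sphere induced by \<open>p / q\<close>; the value at
  \<open>Infty\<close> is the limit of \<open>p t / q t\<close> as \<open>t\<close> tends to infinity.
\<close>

fun rational_map :: "complex poly \<Rightarrow> complex poly \<Rightarrow> riemann_sphere \<Rightarrow> riemann_sphere" where
  "rational_map p q (Fin t) = (if poly q t = 0 then Infty else Fin (poly p t / poly q t))"
| "rational_map p q Infty =
     (if degree p > degree q then Infty else Fin (coeff p (degree q) / lead_coeff q))"

definition normal_on :: "riemann_sphere set \<Rightarrow> (riemann_sphere \<Rightarrow> riemann_sphere) set \<Rightarrow> bool" where
  "normal_on U F \<longleftrightarrow>
     (\<forall>f :: nat \<Rightarrow> riemann_sphere \<Rightarrow> riemann_sphere. range f \<subseteq> F \<longrightarrow>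
       (\<exists>r g. strict_mono (r :: nat \<Rightarrow> nat) \<and>
         (\<forall>K. compact K \<and> K \<subseteq> U \<longrightarrow> uniform_limit K (f \<circ> r) g sequentially)))"

definition Fatou_set :: "(riemann_sphere \<Rightarrow> riemann_sphere) \<Rightarrow> riemann_sphere set" where
  "Fatou_set f = \<Union>{U. open U \<and> normal_on U (range (\<lambda>n. f ^^ n))}"

definition Julia_set :: "(riemann_sphere \<Rightarrow> riemann_sphere) \<Rightarrow> riemann_sphere set" where
  "Julia_set f = - Fatou_set f"

definition Cantor_space :: "'a topology \<Rightarrow> bool" where
  "Cantor_space X \<longleftrightarrow>
     topspace X \<noteq> {} \<and> compact_space X \<and> metrizable_space X \<and>
     X derived_set_of topspace X = topspace X \<and>
     (\<forall>C. connectedin X C \<longrightarrow> (\<exists>a. C \<subseteq> {a}))"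

lemma normal_on_Union:
  assumes op: "\<And>U. U \<in> \<U> \<Longrightarrow> open U" and nm: "\<And>U. U \<in> \<U> \<Longrightarrow> normal_on U F"
  shows "normal_on (\<Union>\<U>) F"
  unfolding normal_on_def
proof (intro allI impI)
  fix f :: "nat \<Rightarrow> riemann_sphere \<Rightarrow> riemann_sphere" assume f: "range f \<subseteq> F"
  have "\<exists>C. finite C \<and> (UNIV :: riemann_sphere set) \<subseteq> (\<Union>c\<in>C. ball c (1 / Suc n))" for n
  proof -
    have "\<forall>e>0. \<exists>k. finite k \<and> k \<subseteq> (UNIV :: riemann_sphere set) \<and> UNIV \<subseteq> (\<Union>x\<in>k. ball x e)"
      using compact_UNIV_riemann_sphere unfolding compact_eq_totally_bounded by blast
    moreover have "1 / real (Suc n) > 0" by simp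
    ultimately show ?thesis by blast
  qed
  then obtain C :: "nat \<Rightarrow> riemann_sphere set"
    where fin: "\<And>n. finite (C n)" and cov: "\<And>n. UNIV \<subseteq> (\<Union>c\<in>C n. ball c (1 / Suc n))"
    by metis
  define I where "I = {(c, n). c \<in> C n \<and> (\<exists>U\<in>\<U>. cball c (1 / Suc n) \<subseteq> U)}"
  define D where "D = (\<lambda>(c :: riemann_sphere, n :: nat). cball c (1 / Suc n))"
  define B where "B = (\<lambda>(c :: riemann_sphere, n :: nat). ball c (1 / Suc n))"
  have "I \<subseteq> (\<Union>n. C n \<times> {n})" unfolding I_def by auto
  moreover have "countable (\<Union>n. C n \<times> {n})" using fin by (intro countable_UN) (auto simp: countable_finite)
  ultimately have cI: "countable I" by (rule countable_subset)
  have BI: "\<exists>i\<in>I. x \<in> B i" if "x \<in> \<Union>\<U>" for x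
  proof -
    from that obtain U where U: "U \<in> \<U>" "x \<in> U" by blast
    then obtain e where e: "e > 0" "ball x e \<subseteq> U" using op open_contains_ball by blast
    obtain n where n: "1 / Suc n < e / 2"
      using nat_approx_posE[of "e / 2"] e by (auto simp: field_simps)
    obtain c where c: "c \<in> C n" "dist c x < 1 / Suc n" using cov[of n] by (auto simp: subset_iff)
    have "cball c (1 / Suc n) \<subseteq> ball x e"
    proof
      fix y assume "y \<in> cball c (1 / Suc n)"
      then have "dist x y < e"
        using dist_triangle[of x y c] c n by (simp add: dist_commute)
      then show "y \<in> ball x e" by simp
    qed
    then have "(c, n) \<in> I" using c e U unfolding I_def by blast
    then show ?thesis using c by (force simp: B_def)
  qed
  show "\<exists>r g. strict_mono r \<and>
         (\<forall>K. compact K \<and> K \<subseteq> \<Union>\<U> \<longrightarrow> uniform_limit K (f \<circ> r) g sequentially)"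
  proof (cases "I = {}")
    case True
    then have "\<Union>\<U> = {}" using BI by blast
    show ?thesis
      unfolding \<open>\<Union>\<U> = {}\<close> by (intro exI[of _ id]) (simp add: strict_mono_id uniform_limit_iff)
  next
    case False
    define i where "i = from_nat_into I"
    have iI: "i n \<in> I" for n unfolding i_def using False by (rule from_nat_into)
    define P where "P = (\<lambda>n s. \<exists>g. uniform_limit (D (i n)) (f \<circ> s) g sequentially)"
    interpret subseqs P
    proof
      fix n and s :: "nat \<Rightarrow> nat" assume "strict_mono s"
      obtain c m where cm: "i n = (c, m)" by force
      then obtain U where U: "U \<in> \<U>" "cball c (1 / Suc m) \<subseteq> U"
        using iI[of n] unfolding I_def by auto
      have "compact (cball c (1 / Suc m))"
        using compact_Int_closed[OF compact_UNIV_riemann_sphere closed_cball] by simp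
      moreover have "range (f \<circ> s) \<subseteq> F" using f by auto
      ultimately obtain r g where "strict_mono r"
        "uniform_limit (cball c (1 / Suc m)) ((f \<circ> s) \<circ> r) g sequentially"
        using nm[OF U(1)] U(2) unfolding normal_on_def by metis
      then show "\<exists>r'. strict_mono r' \<and> P n (s \<circ> r')"
        unfolding P_def D_def cm by (auto simp: o_assoc)
    qed
    have sub: "\<exists>g. uniform_limit (D (i n)) (f \<circ> diagseq) g sequentially" for n
    proof -
      have "P n (diagseq \<circ> ((+) (Suc n)))"
      proof (rule diagseq_holds)
        fix r s :: "nat \<Rightarrow> nat" and n assume r: "strict_mono r" and "P n s"
        then obtain g where "uniform_limit (D (i n)) (f \<circ> s) g sequentially"
          unfolding P_def by blast
        then have "uniform_limit (D (i n)) (\<lambda>k. (f \<circ> s) (r k)) g sequentially"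
          using filterlim_compose filterlim_subseq[OF r] by blast
        then show "P n (s \<circ> r)" unfolding P_def by (auto simp: o_def)
      qed
      then obtain g where
        g: "uniform_limit (D (i n)) (\<lambda>k. f (diagseq (k + Suc n))) g sequentially"
        unfolding P_def by (auto simp: o_def add.commute)
      have "uniform_limit (D (i n)) (\<lambda>k. f (diagseq k)) g sequentially"
        using g unfolding uniform_limit_iff
          eventually_sequentially_seg[of "\<lambda>k. \<forall>x\<in>D (i n). dist (f (diagseq k) x) (g x) < _" "Suc n"] .
      then show ?thesis by (auto simp: o_def)
    qed
    then obtain g where g: "\<And>n. uniform_limit (D (i n)) (f \<circ> diagseq) (g n) sequentially"
      by metis
    define h where "h = (\<lambda>x. lim (\<lambda>k. f (diagseq k) x))"
    have gh: "uniform_limit (D (i n)) (f \<circ> diagseq) h sequentially" for n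
    proof -
      have "g n x = h x" if "x \<in> D (i n)" for x
        using tendsto_uniform_limitI[OF g that] unfolding h_def o_def by (simp add: limI)
      then show ?thesis using g[of n]
        by (auto simp: uniform_limit_iff)
    qed
    have "uniform_limit K (f \<circ> diagseq) h sequentially" if K: "compact K" "K \<subseteq> \<Union>\<U>" for K
    proof -
      have "K \<subseteq> (\<Union>j\<in>I. B j)" using BI K by blast
      then obtain J where J: "J \<subseteq> I" "finite J" "K \<subseteq> (\<Union>j\<in>J. B j)"
        using compactE_image[OF K(1), of I B] by (force simp: B_def split: prod.splits)
      have "uniform_limit (D j) (f \<circ> diagseq) h sequentially" if "j \<in> J" for j
        using gh from_nat_into_surj[OF cI, of j] that J unfolding i_def by blast
      then have "uniform_limit (\<Union>j\<in>J. D j) (f \<circ> diagseq) h sequentially"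
        using J(2) by (intro uniform_limit_on_UNION)
      moreover have "K \<subseteq> (\<Union>j\<in>J. D j)"
      proof -
        have "B j \<subseteq> D j" for j by (cases j) (simp add: B_def D_def)
        then have "(\<Union>j\<in>J. B j) \<subseteq> (\<Union>j\<in>J. D j)" by (rule UN_mono[OF subset_refl])
        then show ?thesis using J(3) by (rule subset_trans[rotated])
      qed
      ultimately show ?thesis by (rule uniform_limit_on_subset)
    qed
    then show ?thesis using subseq_diagseq by (intro exI[of _ diagseq] exI[of _ h]) simp
  qed
qed

lemma Fatou_set_largest:
  shows "open (Fatou_set f)" and "normal_on (Fatou_set f) (range (\<lambda>n. f ^^ n))"
    and "open U \<Longrightarrow> normal_on U (range (\<lambda>n. f ^^ n)) \<Longrightarrow> U \<subseteq> Fatou_set f"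
  unfolding Fatou_set_def by (auto intro!: normal_on_Union)

definition \<beta> :: "riemann_sphere \<Rightarrow> riemann_sphere" where
  "\<beta> = rational_map [:27, -76, 44:] [:62, -120, 56:]"

lemma \<beta>_Fin:
  "\<beta> (Fin t) = (if 56 * t\<^sup>2 - 120 * t + 62 = 0 then Infty
     else Fin ((44 * t\<^sup>2 - 76 * t + 27) / (56 * t\<^sup>2 - 120 * t + 62)))"
  by (simp add: \<beta>_def power2_eq_square algebra_simps)

lemma \<beta>_Infty: "\<beta> Infty = Fin (11 / 14)"
  by (simp add: \<beta>_def)

lemma \<beta>_coprime: "coprime [:27, -76, 44 :: complex:] [:62, -120, 56:]"
proof (rule coprimeI)
  fix d :: "complex poly" assume d: "d dvd [:27, -76, 44:]" "d dvd [:62, -120, 56:]"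
  have "d dvd [:1498, -1568:] * [:27, -76, 44:] + [:-665, 1232:] * [:62, -120, 56:]"
    using d by (intro dvd_add dvd_mult)
  then have "d dvd [:-784:]" by simp
  then show "is_unit d" by (rule dvd_trans) (simp add: is_unit_const_poly_iff dvd_field_iff)
qed

end

(*
In the coordinate S = (2 t - 5) / (t - 1) the map is B(S) = 28 / S + 36 / (S + 16), and the interval
X = [1, 5/2], whose end points form a repelling 2-cycle, becomes the negative real axis with infinity.
Since B maps the slit plane into itself, the iterates on the complement of X are, after a square
root and a Cayley transform, holomorphic self-maps of the unit disc; by Montel they are normal.
So the Julia set lies in the set \<Lambda> of points whose orbit stays in X.  On X the map has two inverse
branches onto disjoint intervals J1, J2, and it expands each of them onto X in the coordinate
V = 1 / (3 t - 1), with factor at least 4/3.  Expansion makes \<Lambda> totally disconnected, and pulling back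
along itineraries gives points of \<Lambda> arbitrarily close to any x in \<Lambda> whose orbits separate from that
of x by a fixed distance; this yields both perfectness and failure of normality.
*)

theory Submission
  imports Defs "HOL-Complex_Analysis.Great_Picard"
begin

section \<open>Homogeneous coordinates and continuity\<close>

text \<open>The point with homogeneous coordinates [u : v]. The pair (0, 0) is sent to
  \<open>Infty\<close> by convention, hence the nonvanishing hypotheses below.\<close>

definition proj :: "complex \<Rightarrow> complex \<Rightarrow> riemann_sphere" where
  "proj u v = (if v = 0 then Infty else Fin (u / v))"

lemma proj_scale: "k \<noteq> 0 \<Longrightarrow> proj (k * u) (k * v) = proj u v"
  by (simp add: proj_def)

text \<open>Clearing (cmod v)^2 from the denominators of \<open>stereo\<close> gives one formula for
  finite points and \<open>Infty\<close> alike, so continuity at \<open>Infty\<close> becomes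
  visible.\<close>

lemma stereo_proj:
  assumes "u \<noteq> 0 \<or> v \<noteq> 0"
  shows "stereo (proj u v) =
    ((2 / ((cmod u)\<^sup>2 + (cmod v)\<^sup>2)) *\<^sub>R (u * cnj v),
     ((cmod u)\<^sup>2 - (cmod v)\<^sup>2) / ((cmod u)\<^sup>2 + (cmod v)\<^sup>2))"
proof (cases "v = 0")
  case True
  then show ?thesis using assms by (simp add: proj_def)
next
  case False
  define n where "n = (cmod u)\<^sup>2 + (cmod v)\<^sup>2"
  have v2: "(cmod v)\<^sup>2 > 0" using False by simp
  have n: "n > 0" unfolding n_def using v2 by (simp add: add_nonneg_pos)
  have s: "1 + (cmod (u / v))\<^sup>2 = n / (cmod v)\<^sup>2"
    using v2 by (simp add: n_def norm_divide power_divide add_divide_distrib)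
  have s': "(cmod (u / v))\<^sup>2 - 1 = ((cmod u)\<^sup>2 - (cmod v)\<^sup>2) / (cmod v)\<^sup>2"
    using v2 by (simp add: norm_divide power_divide diff_divide_distrib)
  have "(cmod v)\<^sup>2 *\<^sub>R (u / v) = u * cnj v"
    using False unfolding scaleR_conv_of_real complex_norm_square by simp
  then have "(2 * (cmod v)\<^sup>2 / n) *\<^sub>R (u / v) = (2 / n) *\<^sub>R (u * cnj v)"
    by (metis (no_types) scaleR_scaleR times_divide_eq_left)
  then show ?thesis
    using False v2 n unfolding n_def[symmetric]
    by (simp add: proj_def s s')
qed

lemma continuous_on_sphereI:
  fixes f :: "'a :: metric_space \<Rightarrow> riemann_sphere"
  assumes "continuous_on S (\<lambda>x. stereo (f x))"
  shows "continuous_on S f"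
  using assms unfolding continuous_on_iff dist_riemann_sphere_def .

lemma continuous_on_proj:
  fixes u v :: "'a :: metric_space \<Rightarrow> complex"
  assumes u: "continuous_on S u" and v: "continuous_on S v"
    and nz: "\<And>x. x \<in> S \<Longrightarrow> u x \<noteq> 0 \<or> v x \<noteq> 0"
  shows "continuous_on S (\<lambda>x. proj (u x) (v x))"
proof (rule continuous_on_sphereI)
  have "(cmod (u x))\<^sup>2 + (cmod (v x))\<^sup>2 \<noteq> 0" if "x \<in> S" for x
    using nz[OF that] by (simp add: sum_power2_eq_zero_iff)
  then have "continuous_on S (\<lambda>x. ((2 / ((cmod (u x))\<^sup>2 + (cmod (v x))\<^sup>2)) *\<^sub>R (u x * cnj (v x)),
     ((cmod (u x))\<^sup>2 - (cmod (v x))\<^sup>2) / ((cmod (u x))\<^sup>2 + (cmod (v x))\<^sup>2)))"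
    by (intro continuous_intros u v) auto
  then show "continuous_on S (\<lambda>x. stereo (proj (u x) (v x)))"
    by (rule continuous_on_eq) (simp only: stereo_proj[OF nz])
qed

lemma \<beta>_proj:
  assumes "u \<noteq> 0 \<or> v \<noteq> 0"
  shows "\<beta> (proj u v) =
    proj (44 * u\<^sup>2 - 76 * u * v + 27 * v\<^sup>2) (56 * u\<^sup>2 - 120 * u * v + 62 * v\<^sup>2)"
proof (cases "v = 0")
  case True
  then show ?thesis using assms by (simp add: proj_def \<beta>_Infty)
next
  case False
  have "44 * u\<^sup>2 - 76 * u * v + 27 * v\<^sup>2 = v\<^sup>2 * (44 * (u / v)\<^sup>2 - 76 * (u / v) + 27)"
    "56 * u\<^sup>2 - 120 * u * v + 62 * v\<^sup>2 = v\<^sup>2 * (56 * (u / v)\<^sup>2 - 120 * (u / v) + 62)"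
    using False by (simp_all add: field_simps power2_eq_square)
  then show ?thesis
    using False by (simp add: proj_scale) (simp add: proj_def \<beta>_Fin)
qed

text \<open>The identity in the proof is the homogenised Bezout relation behind
  \<open>\<beta>_coprime\<close>. It forces v = 0, and then the first form forces u = 0.\<close>

lemma \<beta>_proj_nonzero:
  fixes u v :: complex
  assumes "u \<noteq> 0 \<or> v \<noteq> 0"
  shows "44 * u\<^sup>2 - 76 * u * v + 27 * v\<^sup>2 \<noteq> 0 \<or> 56 * u\<^sup>2 - 120 * u * v + 62 * v\<^sup>2 \<noteq> 0"
proof (rule ccontr)
  assume "\<not> ?thesis"
  then have P: "44 * u\<^sup>2 - 76 * u * v + 27 * v\<^sup>2 = 0"
    and Q: "56 * u\<^sup>2 - 120 * u * v + 62 * v\<^sup>2 = 0" by auto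
  have "(1498 * v - 1568 * u) * (44 * u\<^sup>2 - 76 * u * v + 27 * v\<^sup>2)
      + (1232 * u - 665 * v) * (56 * u\<^sup>2 - 120 * u * v + 62 * v\<^sup>2) = - 784 * v ^ 3"
    by (simp add: power2_eq_square power3_eq_cube algebra_simps)
  then have "v = 0" unfolding P Q by simp
  then show False using P assms by simp
qed

text \<open>Two charts cover the sphere. With (w, h) = \<open>stereo x\<close>, the homogeneous
  coordinates [w : 1 - h] serve off \<open>Infty\<close> and [1 + h : cnj w] off
  \<open>Fin 0\<close>. Both depend continuously on \<open>x\<close>, and in them
  \<open>\<beta>\<close> is a pair of quadratic forms.\<close>

lemma continuous_on_\<beta>: "continuous_on UNIV \<beta>"
proof -
  let ?p = "\<lambda>u v :: complex. proj (44 * u\<^sup>2 - 76 * u * v + 27 * v\<^sup>2) (56 * u\<^sup>2 - 120 * u * v + 62 * v\<^sup>2)"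
  have *: "continuous_on A \<beta>"
    if c: "continuous_on A u" "continuous_on A v"
      and nz: "\<And>x. x \<in> A \<Longrightarrow> u x \<noteq> 0 \<or> v x \<noteq> 0" and eq: "\<And>x. x \<in> A \<Longrightarrow> proj (u x) (v x) = x"
    for A u v
  proof -
    have "continuous_on A (\<lambda>x. ?p (u x) (v x))"
      by (intro continuous_on_proj continuous_intros c \<beta>_proj_nonzero nz)
    then show ?thesis
      by (rule continuous_on_eq) (metis \<beta>_proj nz eq)
  qed
  \<comment> \<open>At \<open>Fin z\<close> the first chart gives (z, 1) times 2 / (1 + |z|^2), and
    the second gives (z, 1) times that factor and \<open>cnj z\<close>.\<close>
  have height: "1 - snd (stereo (Fin z)) = 2 / (1 + (cmod z)\<^sup>2)"
    "1 + snd (stereo (Fin z)) = 2 * (cmod z)\<^sup>2 / (1 + (cmod z)\<^sup>2)" for z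
    using one_plus_sq_pos[of z] by (simp_all add: field_simps)
  have A: "continuous_on (- {Infty}) \<beta>"
  proof (rule *)
    fix x :: riemann_sphere assume "x \<in> - {Infty}"
    then obtain z where z: "x = Fin z" by (cases x) auto
    have nz: "complex_of_real (2 / (1 + (cmod z)\<^sup>2)) \<noteq> 0"
      using one_plus_sq_pos[of z] by (simp only: of_real_eq_0_iff) simp
    show "fst (stereo x) \<noteq> 0 \<or> of_real (1 - snd (stereo x)) \<noteq> (0 :: complex)"
      unfolding z height using nz by blast
    have "proj (of_real (2 / (1 + (cmod z)\<^sup>2)) * z) (of_real (2 / (1 + (cmod z)\<^sup>2)) * 1) = Fin z"
      unfolding proj_scale[OF nz] by (simp add: proj_def)
    then show "proj (fst (stereo x)) (of_real (1 - snd (stereo x))) = x"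
      unfolding z height by (simp add: scaleR_conv_of_real)
  qed (intro continuous_intros continuous_on_stereo)+
  have B: "continuous_on (- {Fin 0}) \<beta>"
  proof (rule *)
    fix x :: riemann_sphere assume x: "x \<in> - {Fin 0}"
    have "of_real (1 + snd (stereo x)) \<noteq> (0 :: complex) \<and>
      proj (of_real (1 + snd (stereo x))) (cnj (fst (stereo x))) = x"
    proof (cases x)
      case (Fin z)
      then have z: "z \<noteq> 0" using x by auto
      have p: "2 * (cmod z)\<^sup>2 / (1 + (cmod z)\<^sup>2) \<noteq> 0"
        using one_plus_sq_pos[of z] z by simp
      have nz: "complex_of_real (2 / (1 + (cmod z)\<^sup>2)) * cnj z \<noteq> 0"
        using one_plus_sq_pos[of z] z
        by (metis complex_cnj_zero_iff divide_eq_0_iff less_irrefl mult_eq_0_iff of_real_eq_0_iff zero_neq_numeral)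
      have "proj (of_real (2 / (1 + (cmod z)\<^sup>2)) * cnj z * z)
          (of_real (2 / (1 + (cmod z)\<^sup>2)) * cnj z * 1) = Fin z"
        unfolding proj_scale[OF nz] by (simp add: proj_def)
      moreover have "of_real (2 / (1 + (cmod z)\<^sup>2)) * cnj z * z
          = complex_of_real (2 * (cmod z)\<^sup>2 / (1 + (cmod z)\<^sup>2))"
        using complex_norm_square[of z] by (simp add: mult_ac)
      ultimately show ?thesis
        using p unfolding Fin height by (simp add: scaleR_conv_of_real del: of_real_divide)
    qed (simp add: proj_def)
    then show "of_real (1 + snd (stereo x)) \<noteq> (0 :: complex) \<or> cnj (fst (stereo x)) \<noteq> 0"
      and "proj (of_real (1 + snd (stereo x))) (cnj (fst (stereo x))) = x" by auto
  qed (intro continuous_intros continuous_on_stereo)+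
  have "continuous_on (- {Infty} \<union> - {Fin 0}) \<beta>"
    by (intro continuous_on_open_Un A B) auto
  moreover have "- {Infty} \<union> - {Fin 0} = UNIV" by auto
  ultimately show ?thesis by simp
qed

lemma continuous_on_funpow:
  fixes f :: "'a :: topological_space \<Rightarrow> 'a"
  assumes "continuous_on UNIV f"
  shows "continuous_on UNIV (f ^^ n)"
proof (induction n)
  case (Suc n)
  have "continuous_on ((f ^^ n) ` UNIV) f" using assms continuous_on_subset by blast
  then show ?case unfolding funpow.simps by (rule continuous_on_compose[OF Suc])
qed (simp add: id_def)

section \<open>Dynamics on the real interval\<close>

definition b :: "real \<Rightarrow> real" where
  "b t = (44 * t\<^sup>2 - 76 * t + 27) / (56 * t\<^sup>2 - 120 * t + 62)"

text \<open>The ends of \<open>J1\<close> and \<open>J2\<close> are the solutions of b t = 1 and b t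
  = 5/2. Each piece is a full branch over [1, 5/2], and the gap between them contains a pole of
  \<open>b\<close>.\<close>

definition J1 :: "real set" where "J1 = {1..7/6}"
definition J2 :: "real set" where "J2 = {4/3..5/2}"

text \<open>
  The Euclidean derivative of \<open>b\<close> at \<open>5/2\<close> is \<open>-1/7\<close> and at \<open>1\<close> it is \<open>-16\<close>; the pole of \<open>V\<close> is
  chosen so that both become about \<open>3/2\<close> in absolute value.
\<close>

definition V :: "real \<Rightarrow> real" where "V t = 1 / (3 * t - 1)"

text \<open>A convex quadratic lies below its chord, and the chord over \<open>J1\<close> is
  negative.\<close>

lemma denom_neg:
  assumes "t \<in> J1" shows "56 * t\<^sup>2 - 120 * t + 62 < 0"
proof -
  have "(t - 1) * (7 / 6 - t) \<ge> 0" using assms by (simp add: J1_def)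
  moreover have "(t - 1) * (7 / 6 - t) = 13 / 6 * t - 7 / 6 - t\<^sup>2"
    by (simp add: field_simps power2_eq_square)
  ultimately show ?thesis using assms unfolding J1_def atLeastAtMost_iff by linarith
qed

text \<open>Subtracting the positive value at the left end 4/3 leaves a product of two factors that
  are nonnegative on \<open>J2\<close>.\<close>

lemma denom_pos:
  assumes "t \<in> J2" shows "56 * t\<^sup>2 - 120 * t + 62 > 0"
proof -
  have "(t - 4 / 3) * (56 * t - 136 / 3) \<ge> 0" using assms by (simp add: J2_def)
  moreover have "(t - 4 / 3) * (56 * t - 136 / 3) = 56 * t\<^sup>2 - 120 * t + 544 / 9"
    by (simp add: field_simps power2_eq_square)
  ultimately show ?thesis by linarith
qed

lemma denom_nz: "t \<in> J1 \<union> J2 \<Longrightarrow> 56 * t\<^sup>2 - 120 * t + 62 \<noteq> 0"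
  using denom_neg denom_pos by fastforce

text \<open>This quadratic is the numerator of 3 * b t - 1, hence the denominator of
  \<open>V (b t)\<close>. The chord argument bounds it again.\<close>

lemma V_denom_neg:
  assumes "t \<in> J1" shows "76 * t\<^sup>2 - 108 * t + 19 < (0::real)"
proof -
  have "(t - 1) * (7 / 6 - t) \<ge> 0" using assms by (simp add: J1_def)
  moreover have "(t - 1) * (7 / 6 - t) = 13 / 6 * t - 7 / 6 - t\<^sup>2"
    by (simp add: field_simps power2_eq_square)
  ultimately show ?thesis using assms unfolding J1_def atLeastAtMost_iff by linarith
qed

lemma V_denom_pos:
  assumes "t \<in> J2" shows "76 * t\<^sup>2 - 108 * t + 19 > (0::real)"
proof -
  have "(t - 4 / 3) * (76 * t - 20 / 3) \<ge> 0" using assms by (simp add: J2_def)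
  moreover have "(t - 4 / 3) * (76 * t - 20 / 3) = 76 * t\<^sup>2 - 108 * t + 80 / 9"
    by (simp add: field_simps power2_eq_square)
  ultimately show ?thesis by linarith
qed

lemma V_b:
  assumes "t \<in> J1 \<union> J2"
  shows "V (b t) = (56 * t\<^sup>2 - 120 * t + 62) / (76 * t\<^sup>2 - 108 * t + 19)"
proof -
  let ?q = "56 * t\<^sup>2 - 120 * t + 62"
  have "3 * b t - 1 = (76 * t\<^sup>2 - 108 * t + 19) / ?q"
    using denom_nz[OF assms] unfolding b_def by (simp add: divide_simps)
  then show ?thesis by (simp add: V_def)
qed

text \<open>
  Both sides differ by a polynomial whose Bernstein coefficients on \<open>J \<times> J\<close> are all positive.
\<close>

lemma expansion_poly:
  assumes "x \<in> J \<and> y \<in> J" "J = J1 \<or> J = J2"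
  shows "(76 * x\<^sup>2 - 108 * x + 19) * (76 * y\<^sup>2 - 108 * y + 19)
    \<le> 48 * (16 * x * y - 19 * (x + y) + 23) * (3 * x - 1) * (3 * y - 1)"
  (is "?l \<le> ?r")
proof (cases "J = J1")
  case True
  define p p' q q' where pq: "p = 6 * x - 6" "p' = 7 - 6 * x" "q = 6 * y - 6" "q' = 7 - 6 * y"
  have nn: "p \<ge> 0" "p' \<ge> 0" "q \<ge> 0" "q' \<ge> 0"
    using assms True by (auto simp: pq J1_def)
  have "81 * (?r - ?l) = 1863 * (p'\<^sup>2 * q'\<^sup>2) + 7560 * (p'\<^sup>2 * (q * q') + p * p' * q'\<^sup>2)
      + 5976 * (p'\<^sup>2 * q\<^sup>2 + p\<^sup>2 * q'\<^sup>2) + 22428 * (p * p' * (q * q'))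
      + 15414 * (p * p' * q\<^sup>2 + p\<^sup>2 * (q * q')) + 9776 * (p\<^sup>2 * q\<^sup>2)"
    unfolding pq by (simp add: power2_eq_square algebra_simps)
  also have "\<dots> \<ge> 0" using nn by (intro add_nonneg_nonneg mult_nonneg_nonneg) auto
  finally show ?thesis by simp
next
  case False
  \<comment> \<open>Here p + p' = q + q' = 7, so homogenising to bidegree (2, 2) costs the factor
    7^4 = 2401; on \<open>J1\<close> the sums are 1.\<close>
  define p p' q q' where pq: "p = 6 * x - 8" "p' = 15 - 6 * x" "q = 6 * y - 8" "q' = 15 - 6 * y"
  have nn: "p \<ge> 0" "p' \<ge> 0" "q \<ge> 0" "q' \<ge> 0"
    using assms False by (auto simp: pq J2_def)
  have "81 * 2401 * (?r - ?l) = 18935 * (p'\<^sup>2 * q'\<^sup>2) + 74424 * (p'\<^sup>2 * (q * q') + p * p' * q'\<^sup>2)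
      + 81900 * (p'\<^sup>2 * q\<^sup>2 + p\<^sup>2 * q'\<^sup>2) + 255276 * (p * p' * (q * q'))
      + 326970 * (p * p' * q\<^sup>2 + p\<^sup>2 * (q * q')) + 535248 * (p\<^sup>2 * q\<^sup>2)"
    unfolding pq by (simp add: power2_eq_square algebra_simps)
  also have "\<dots> \<ge> 0" using nn by (intro add_nonneg_nonneg mult_nonneg_nonneg) auto
  finally show ?thesis by simp
qed

text \<open>Both differences contain the factor x - y: V x - V y = 3 (y - x) / (x' y') and V (b x) -
  V (b y) = 192 (x - y) N / (X Y). Cancelling it reduces the bound to \<open>expansion_poly\<close>,
  without derivatives.\<close>

lemma V_expansion:
  assumes xy: "x \<in> J" "y \<in> J" and J: "J = J1 \<or> J = J2"
  shows "\<bar>V (b x) - V (b y)\<bar> \<ge> 4 / 3 * \<bar>V x - V y\<bar>"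
proof -
  define X Y N where "X = 76 * x\<^sup>2 - 108 * x + 19" and "Y = 76 * y\<^sup>2 - 108 * y + 19"
    and "N = 16 * x * y - 19 * (x + y) + 23"
  have XY: "X * Y > 0" "X \<noteq> 0" "Y \<noteq> 0"
    using xy J V_denom_neg[of x] V_denom_neg[of y] V_denom_pos[of x] V_denom_pos[of y]
    by (auto simp: X_def Y_def mult_neg_neg)
  define x' y' where "x' = 3 * x - 1" and "y' = 3 * y - 1"
  have pos: "x' > 0" "y' > 0" using xy J by (auto simp: J1_def J2_def x'_def y'_def)
  have le: "X * Y \<le> 48 * N * x' * y'"
    using expansion_poly[of x J y] xy J unfolding X_def Y_def N_def x'_def y'_def by blast
  then have N: "N > 0"
    using XY(1) pos by (smt (verit) mult_nonneg_nonneg mult_nonpos_nonneg zero_less_mult_iff)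
  have "V (b x) - V (b y) = (56 * x\<^sup>2 - 120 * x + 62) / X - (56 * y\<^sup>2 - 120 * y + 62) / Y"
    using V_b[of x] V_b[of y] xy J unfolding X_def Y_def by auto
  also have "\<dots> = ((56 * x\<^sup>2 - 120 * x + 62) * Y - (56 * y\<^sup>2 - 120 * y + 62) * X) / (X * Y)"
    using XY by (simp add: field_simps)
  also have "(56 * x\<^sup>2 - 120 * x + 62) * Y - (56 * y\<^sup>2 - 120 * y + 62) * X = 192 * (x - y) * N"
    unfolding X_def Y_def N_def by (simp add: power2_eq_square algebra_simps)
  finally have "V (b x) - V (b y) = 192 * (x - y) * N / (X * Y)" .
  moreover have "\<bar>192 * (x - y) * N\<bar> = 192 * \<bar>x - y\<bar> * N"
    using N by (simp only: abs_mult)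
  ultimately have 1: "\<bar>V (b x) - V (b y)\<bar> = 192 * \<bar>x - y\<bar> * N / (X * Y)"
    using XY(1) by (simp only: abs_divide abs_of_pos)
  have "V x - V y = 3 * (y - x) / (x' * y')"
    using pos unfolding V_def x'_def y'_def by (simp add: divide_simps)
  then have 2: "\<bar>V x - V y\<bar> = 3 * \<bar>x - y\<bar> / (x' * y')"
    using pos by (simp only: abs_divide abs_mult abs_of_pos abs_minus_commute[of y])
  have "4 * (X * Y) * \<bar>x - y\<bar> \<le> 4 * (48 * N * x' * y') * \<bar>x - y\<bar>"
    using le by (intro mult_right_mono) auto
  then show ?thesis
    unfolding 1 2 using XY(1) pos by (simp add: divide_simps mult_ac)
qed

text \<open>|x - y| = x' y' |V x - V y| / 3, where x' and y' are at most 13/2 and (13/2)^2 <=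
  45.\<close>

lemma V_lower:
  assumes "x \<in> {1..5/2}" "y \<in> {1..5/2}"
  shows "\<bar>x - y\<bar> \<le> 15 * \<bar>V x - V y\<bar>"
proof -
  define x' y' where "x' = 3 * x - 1" and "y' = 3 * y - 1"
  have pos: "x' > 0" "y' > 0" "x' \<le> 13 / 2" "y' \<le> 13 / 2"
    using assms by (auto simp: x'_def y'_def)
  have "V x - V y = 3 * (y - x) / (x' * y')"
    using pos unfolding V_def x'_def y'_def by (simp add: divide_simps)
  then have 2: "\<bar>V x - V y\<bar> = 3 * \<bar>x - y\<bar> / (x' * y')"
    using pos by (simp only: abs_divide abs_mult abs_of_pos abs_minus_commute[of y])
  have "x' * y' \<le> 13 / 2 * (13 / 2)" using pos by (intro mult_mono) auto
  then have "\<bar>x - y\<bar> * (x' * y') \<le> \<bar>x - y\<bar> * 45" by (intro mult_left_mono) auto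
  then show ?thesis unfolding 2 using pos by (simp add: divide_simps)
qed

lemma V_upper:
  assumes "x \<in> {1..5/2}" "y \<in> {1..5/2}"
  shows "\<bar>V x - V y\<bar> \<le> 1"
proof -
  have "0 \<le> V x" "V x \<le> 1" "0 \<le> V y" "V y \<le> 1" using assms by (auto simp: V_def divide_simps)
  then show ?thesis by linarith
qed

text \<open>Intermediate value theorem: neither piece contains a pole, and \<open>b\<close> is 5/2
  at the left end and 1 at the right end of each.\<close>

lemma b_surj:
  assumes "J = J1 \<or> J = J2" "y \<in> {1..5/2}"
  shows "\<exists>x\<in>J. b x = y"
proof -
  have c: "continuous_on J1 b" "continuous_on J2 b"
    unfolding b_def by (intro continuous_intros ballI; use denom_nz in blast)+
  have v: "b 1 = 5/2" "b (7/6) = 1" "b (4/3) = 5/2" "b (5/2) = 1"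
    by (simp_all add: b_def power2_eq_square)
  have "\<exists>x\<ge>1. x \<le> 7/6 \<and> b x = y"
    using IVT2'[of b "7/6" y 1] assms(2) c(1) v by (auto simp: J1_def)
  moreover have "\<exists>x\<ge>4/3. x \<le> 5/2 \<and> b x = y"
    using IVT2'[of b "5/2" y "4/3"] assms(2) c(2) v by (auto simp: J2_def)
  ultimately show ?thesis using assms(1) unfolding J1_def J2_def by auto
qed

text \<open>In the gap, b t >= 1 and the factorisation of b t - 1 make the denominator positive,
  whereas b t <= 5/2 and that of 5 - 2 * b t make it negative.\<close>

lemma b_in_interval:
  assumes t: "t \<in> {1..5/2}" and q: "56 * t\<^sup>2 - 120 * t + 62 \<noteq> 0" and bt: "b t \<in> {1..5/2}"
  shows "t \<in> J1 \<union> J2"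
proof (rule ccontr)
  assume "t \<notin> J1 \<union> J2"
  then have gap: "7/6 < t" "t < 4/3" using t by (auto simp: J1_def J2_def)
  let ?q = "56 * t\<^sup>2 - 120 * t + 62"
  have "(b t - 1) * ?q = (5 - 2 * t) * (6 * t - 7)"
    using q unfolding b_def by (simp add: divide_simps) (simp add: algebra_simps power2_eq_square)
  moreover have "\<dots> > 0" using gap by simp
  ultimately have "?q > 0" using bt by (smt (verit) atLeastAtMost_iff mult_nonneg_nonpos)
  have "(5 - 2 * b t) * ?q = 64 * (t - 1) * (3 * t - 4)"
    using q unfolding b_def by (simp add: divide_simps) (simp add: algebra_simps power2_eq_square)
  moreover have "\<dots> < 0" using gap by (simp add: mult_pos_neg)
  moreover have "(5 - 2 * b t) * ?q \<ge> 0" using \<open>?q > 0\<close> bt by (intro mult_nonneg_nonneg) auto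
  ultimately show False by linarith
qed

section \<open>The repeller\<close>

definition E :: "real \<Rightarrow> riemann_sphere" where "E t = Fin (of_real t)"

definition X :: "riemann_sphere set" where "X = E ` {1..5/2}"

definition \<Lambda> :: "riemann_sphere set" where "\<Lambda> = {x. \<forall>n. (\<beta> ^^ n) x \<in> X}"

lemma inj_E: "E s = E t \<longleftrightarrow> s = t"
  by (simp add: E_def)

lemma E_neq_Infty: "E t \<noteq> Infty"
  by (simp add: E_def)

lemma \<beta>_E:
  "\<beta> (E t) = (if 56 * t\<^sup>2 - 120 * t + 62 = 0 then Infty else E (b t))"
proof -
  have "56 * (complex_of_real t)\<^sup>2 - 120 * of_real t + 62 = of_real (56 * t\<^sup>2 - 120 * t + 62)" by simp
  then have "56 * (complex_of_real t)\<^sup>2 - 120 * of_real t + 62 = 0 \<longleftrightarrow> 56 * t\<^sup>2 - 120 * t + 62 = 0"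
    by (simp only: of_real_eq_0_iff)
  then show ?thesis by (simp add: E_def \<beta>_Fin b_def)
qed

lemma continuous_on_E: "continuous_on S E"
proof -
  have "continuous_on S (\<lambda>t. proj (of_real t) 1)"
    by (intro continuous_on_proj continuous_intros) auto
  then show ?thesis by (simp add: proj_def E_def[abs_def])
qed

text \<open>The real part of the affine coordinate, written on the unit sphere so that continuity
  away from \<open>Infty\<close> is immediate. It inverts \<open>E\<close> on
  \<open>X\<close>.\<close>

definition re_coord :: "riemann_sphere \<Rightarrow> real" where
  "re_coord x = Re (fst (stereo x)) / (1 - snd (stereo x))"

lemma re_coord_E: "re_coord (E t) = t"
  using one_plus_sq_pos[of "of_real t"] by (simp add: re_coord_def E_def field_simps)

lemma continuous_on_re_coord: "continuous_on X re_coord"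
proof -
  have "1 - snd (stereo x) \<noteq> 0" if "x \<in> X" for x
  proof -
    from that obtain t where "x = Fin t" unfolding X_def E_def by blast
    then show ?thesis using one_plus_sq_pos[of t] by (simp add: field_simps)
  qed
  then show ?thesis
    unfolding re_coord_def[abs_def] by (intro continuous_intros continuous_on_stereo) auto
qed

lemma compact_X: "compact X"
  unfolding X_def by (intro compact_continuous_image continuous_on_E) auto

lemma \<Lambda>_subset_X: "\<Lambda> \<subseteq> X"
proof
  fix x assume "x \<in> \<Lambda>"
  then have "(\<beta> ^^ 0) x \<in> X" unfolding \<Lambda>_def by blast
  then show "x \<in> X" by simp
qed

lemma \<Lambda>_forward:
  assumes "x \<in> \<Lambda>" shows "\<beta> x \<in> \<Lambda>"
  unfolding \<Lambda>_def mem_Collect_eq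
proof
  fix n
  have "(\<beta> ^^ Suc n) x \<in> X" using assms unfolding \<Lambda>_def by blast
  then show "(\<beta> ^^ n) (\<beta> x) \<in> X" by (simp only: funpow_Suc_right comp_apply)
qed

lemma \<Lambda>_backward:
  assumes "x \<in> X" "\<beta> x \<in> \<Lambda>" shows "x \<in> \<Lambda>"
  unfolding \<Lambda>_def mem_Collect_eq
proof
  fix n show "(\<beta> ^^ n) x \<in> X"
  proof (cases n)
    case (Suc k)
    have "(\<beta> ^^ k) (\<beta> x) \<in> X" using assms(2) unfolding \<Lambda>_def by blast
    then show ?thesis unfolding Suc by (simp only: funpow_Suc_right comp_apply)
  qed (simp add: assms(1))
qed

text \<open>The image of a point of \<open>\<Lambda>\<close> lies in \<open>X\<close>, which rules
  out the pole and the gap. So orbits in \<open>\<Lambda>\<close> can be followed on the real line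
  by \<open>b\<close>.\<close>

lemma \<Lambda>_E:
  assumes "E t \<in> \<Lambda>"
  shows "t \<in> J1 \<union> J2" "t \<in> {1..5/2}" "\<beta> (E t) = E (b t)" "E (b t) \<in> \<Lambda>"
proof -
  have "E t \<in> X" "\<beta> (E t) \<in> X" using assms \<Lambda>_subset_X \<Lambda>_forward by blast+
  then have t: "t \<in> {1..5/2}" and "56 * t\<^sup>2 - 120 * t + 62 \<noteq> 0" "b t \<in> {1..5/2}"
    by (auto simp: X_def inj_E E_neq_Infty E_neq_Infty[symmetric] \<beta>_E split: if_splits)
  then show *: "t \<in> J1 \<union> J2" by (intro b_in_interval)
  show "t \<in> {1..5/2}" by (rule t)
  show "\<beta> (E t) = E (b t)" using denom_nz[OF *] by (simp add: \<beta>_E)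
  then show "E (b t) \<in> \<Lambda>" using \<Lambda>_forward[OF assms] by simp
qed

lemma funpow_E:
  assumes "E t \<in> \<Lambda>"
  shows "(\<beta> ^^ n) (E t) = E ((b ^^ n) t) \<and> E ((b ^^ n) t) \<in> \<Lambda>"
proof (induction n)
  case (Suc n)
  then show ?case using \<Lambda>_E(3,4)[of "(b ^^ n) t"] by simp
qed (simp add: assms)

section \<open>Separated orbits and perfectness\<close>

lemma two_cycle_in_\<Lambda>: "E 1 \<in> \<Lambda>" "E (5/2) \<in> \<Lambda>"
proof -
  have *: "\<beta> (E 1) = E (5/2)" "\<beta> (E (5/2)) = E 1"
    by (simp_all add: \<beta>_E b_def power2_eq_square)
  have "(\<beta> ^^ n) (E 1) \<in> {E 1, E (5/2)} \<and> (\<beta> ^^ n) (E (5/2)) \<in> {E 1, E (5/2)}" for n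
    by (induction n) (use * in auto)
  moreover have "{E 1, E (5/2)} \<subseteq> X" by (auto simp: X_def)
  ultimately show "E 1 \<in> \<Lambda>" "E (5/2) \<in> \<Lambda>" unfolding \<Lambda>_def by blast+
qed

lemma closed_\<Lambda>: "closed \<Lambda>"
proof -
  have "closed ((\<beta> ^^ n) -` X)" for n
    using continuous_on_funpow[OF continuous_on_\<beta>] compact_imp_closed[OF compact_X]
    by (simp add: continuous_on_closed_vimage)
  then have "closed (\<Inter>n. (\<beta> ^^ n) -` X)" by (intro closed_INT ballI)
  moreover have "(\<Inter>n. (\<beta> ^^ n) -` X) = \<Lambda>" by (auto simp: \<Lambda>_def)
  ultimately show ?thesis by simp
qed

text \<open>
  Take the end of the interval that is far from \<open>(b ^^ n) x\<close> and pull it back along the itinerary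
  of \<open>x\<close>.
\<close>

lemma separated_companion:
  assumes "E x \<in> \<Lambda>"
  shows "\<exists>y. E y \<in> \<Lambda> \<and> \<bar>V x - V y\<bar> \<le> (3/4) ^ n \<and> \<bar>(b ^^ n) x - (b ^^ n) y\<bar> \<ge> 3/4"
  using assms
proof (induction n arbitrary: x)
  case 0
  have x: "x \<in> {1..5/2}" using 0 by (rule \<Lambda>_E)
  \<comment> \<open>7/4 is the midpoint of [1, 5/2], so the far end is at distance at least 3/4,
    half the length.\<close>
  define y :: real where "y = (if x \<le> 7/4 then 5/2 else 1)"
  have "E y \<in> \<Lambda>" "y \<in> {1..5/2}" using two_cycle_in_\<Lambda> by (auto simp: y_def)
  moreover have "\<bar>x - y\<bar> \<ge> 3/4" by (auto simp: y_def)
  ultimately show ?case using V_upper[OF x] by (intro exI[of _ y]) simp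
next
  case (Suc n)
  obtain J where J: "J = J1 \<or> J = J2" and xJ: "x \<in> J" using \<Lambda>_E(1)[OF Suc.prems] by blast
  obtain y where y: "E y \<in> \<Lambda>" "\<bar>V (b x) - V y\<bar> \<le> (3/4) ^ n"
      "\<bar>(b ^^ n) (b x) - (b ^^ n) y\<bar> \<ge> 3/4"
    using Suc.IH[OF \<Lambda>_E(4)[OF Suc.prems]] by blast
  \<comment> \<open>The preimage is taken in the branch that contains \<open>x\<close>, so
    \<open>V_expansion\<close> shrinks the distance by 3/4.\<close>
  obtain z where z: "z \<in> J" "b z = y" using b_surj[OF J \<Lambda>_E(2)[OF y(1)]] by blast
  have "E z \<in> X" using z J by (auto simp: X_def J1_def J2_def)
  moreover have "\<beta> (E z) \<in> \<Lambda>" using denom_nz[of z] z J y(1) by (auto simp: \<beta>_E)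
  ultimately have "E z \<in> \<Lambda>" by (rule \<Lambda>_backward)
  moreover have "\<bar>V x - V z\<bar> \<le> (3/4) ^ Suc n"
    using V_expansion[OF xJ z(1) J] z(2) y(2) by simp
  moreover have "\<bar>(b ^^ Suc n) x - (b ^^ Suc n) z\<bar> \<ge> 3/4"
    using y(3) z(2) by (simp add: funpow_Suc_right del: funpow.simps)
  ultimately show ?case by blast
qed

text \<open>Carries \<open>separated_companion\<close> over to the chordal metric:
  \<open>V_lower\<close> turns the geometric decay into convergence, and uniform continuity of
  \<open>re_coord\<close> on the compact set \<open>X\<close> turns the real separation 3/4 into one
  \<delta> valid for all n.\<close>

lemma separated_sequence:
  assumes "x \<in> \<Lambda>"
  obtains y \<delta> where "\<And>n. y n \<in> \<Lambda>" "y \<longlonglongrightarrow> x" "\<delta> > 0"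
    "\<And>n. dist ((\<beta> ^^ n) x) ((\<beta> ^^ n) (y n)) \<ge> \<delta>"
proof -
  obtain t where t: "x = E t" using assms \<Lambda>_subset_X by (auto simp: X_def)
  have Et: "E t \<in> \<Lambda>" using assms t by simp
  obtain s where s: "\<And>n. E (s n) \<in> \<Lambda>" "\<And>n. \<bar>V t - V (s n)\<bar> \<le> (3/4) ^ n"
      "\<And>n. \<bar>(b ^^ n) t - (b ^^ n) (s n)\<bar> \<ge> 3/4"
    using separated_companion[OF Et] by metis
  have "norm (s n - t) \<le> 15 * (3/4) ^ n" for n
  proof -
    have "\<bar>t - s n\<bar> \<le> 15 * \<bar>V t - V (s n)\<bar>" by (intro V_lower \<Lambda>_E(2) Et s(1))
    also have "\<dots> \<le> 15 * (3/4) ^ n" using s(2) by (intro mult_left_mono) auto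
    finally show ?thesis unfolding real_norm_def by (subst abs_minus_commute)
  qed
  moreover have "(\<lambda>n. 15 * (3/4 :: real) ^ n) \<longlonglongrightarrow> 0"
    by (intro tendsto_mult_right_zero LIMSEQ_power_zero) simp
  ultimately have "(\<lambda>n. s n - t) \<longlonglongrightarrow> 0"
    by (intro Lim_null_comparison[of "\<lambda>n. s n - t" "\<lambda>n. 15 * (3/4) ^ n"] always_eventually allI)
  then have "s \<longlonglongrightarrow> t" by (rule LIM_zero_cancel)
  then have lim: "(\<lambda>n. E (s n)) \<longlonglongrightarrow> x"
    unfolding t by (intro continuous_on_tendsto_compose[OF continuous_on_E[of UNIV]]) auto
  have "uniformly_continuous_on X re_coord"
    by (intro compact_uniformly_continuous continuous_on_re_coord compact_X)
  then obtain \<delta> where \<delta>: "\<delta> > 0"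
    "\<And>u v. u \<in> X \<Longrightarrow> v \<in> X \<Longrightarrow> dist u v < \<delta> \<Longrightarrow> dist (re_coord u) (re_coord v) < 3/4"
    unfolding uniformly_continuous_on_def
    by (elim allE[of _ "3/4"]) (auto simp: dist_commute)
  have "dist ((\<beta> ^^ n) x) ((\<beta> ^^ n) (E (s n))) \<ge> \<delta>" for n
  proof (rule ccontr)
    assume "\<not> ?thesis"
    then have "dist (E ((b ^^ n) t)) (E ((b ^^ n) (s n))) < \<delta>"
      using funpow_E[OF Et, of n] funpow_E[OF s(1)[of n], of n] by (simp add: t)
    moreover have "E ((b ^^ n) t) \<in> X" "E ((b ^^ n) (s n)) \<in> X"
      using funpow_E[OF Et, of n] funpow_E[OF s(1)[of n], of n] \<Lambda>_subset_X by blast+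
    ultimately have "dist ((b ^^ n) t) ((b ^^ n) (s n)) < 3/4" using \<delta>(2) by (metis re_coord_E)
    then show False using s(3)[of n] by (simp add: dist_real_def)
  qed
  then show ?thesis using that[of "\<lambda>n. E (s n)" \<delta>] s(1) lim \<delta>(1) by blast
qed

lemma islimpt_\<Lambda>:
  assumes "x \<in> \<Lambda>" shows "x islimpt \<Lambda>"
proof -
  obtain y \<delta> where y: "\<And>n. y n \<in> \<Lambda>" "y \<longlonglongrightarrow> x" "\<delta> > 0"
    "\<And>n. dist ((\<beta> ^^ n) x) ((\<beta> ^^ n) (y n)) \<ge> \<delta>"
    using separated_sequence[OF assms] by metis
  have "y n \<noteq> x" for n using y(3) y(4)[of n] by auto
  then show ?thesis using y(1,2) unfolding islimpt_sequential by blast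
qed

text \<open>The iterates of a connected subset of \<open>\<Lambda>\<close> cannot straddle the gap,
  so any two of its points share an itinerary. Expansion along it would then push a positive
  \<open>V\<close>-distance above the bound 1 of \<open>V_upper\<close>.\<close>

lemma connected_\<Lambda>_subset:
  assumes C: "connected C" "C \<subseteq> \<Lambda>" and xy: "x \<in> C" "y \<in> C"
  shows "x = y"
proof -
  have "x \<in> X" "y \<in> X" using assms \<Lambda>_subset_X by auto
  then obtain s t where st: "x = E s" "y = E t" by (auto simp: X_def)
  have E: "E s \<in> \<Lambda>" "E t \<in> \<Lambda>" using assms st by auto
  have same: "\<exists>J. (J = J1 \<or> J = J2) \<and> (b ^^ n) s \<in> J \<and> (b ^^ n) t \<in> J" for n
  proof (rule ccontr)
    assume neg: "\<not> ?thesis"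
    define D where "D = re_coord ` (\<beta> ^^ n) ` C"
    have sub: "(\<beta> ^^ n) ` C \<subseteq> \<Lambda>"
    proof clarify
      fix z assume "z \<in> C"
      then have "z \<in> \<Lambda>" using C by blast
      then show "(\<beta> ^^ n) z \<in> \<Lambda>" by (induction n) (auto simp: \<Lambda>_forward)
    qed
    have "connected D"
      unfolding D_def
    proof (intro connected_continuous_image C)
      show "continuous_on C (\<beta> ^^ n)"
        using continuous_on_funpow[OF continuous_on_\<beta>] continuous_on_subset by blast
      show "continuous_on ((\<beta> ^^ n) ` C) re_coord"
        using sub \<Lambda>_subset_X by (intro continuous_on_subset[OF continuous_on_re_coord]) auto
    qed
    moreover have "(b ^^ n) s \<in> D" "(b ^^ n) t \<in> D"
      using xy funpow_E[OF E(1), of n] funpow_E[OF E(2), of n]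
      unfolding D_def st by (metis image_eqI re_coord_E)+
    moreover have J: "(b ^^ n) s \<in> J1 \<union> J2" "(b ^^ n) t \<in> J1 \<union> J2"
      using \<Lambda>_E(1) funpow_E E by blast+
    moreover have "\<not> ((b ^^ n) s \<in> J1 \<and> (b ^^ n) t \<in> J1)" "\<not> ((b ^^ n) s \<in> J2 \<and> (b ^^ n) t \<in> J2)"
      using neg by blast+
    \<comment> \<open>5/4 lies in the gap between \<open>J1\<close> and \<open>J2\<close>.\<close>
    then have "(b ^^ n) s \<le> 5/4 \<and> 5/4 \<le> (b ^^ n) t \<or> (b ^^ n) t \<le> 5/4 \<and> 5/4 \<le> (b ^^ n) s"
      using J unfolding J1_def J2_def by auto
    ultimately have "5/4 \<in> D" unfolding connected_iff_interval by blast
    then obtain z where "z \<in> \<Lambda>" "re_coord z = 5/4" unfolding D_def using sub by force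
    moreover then obtain r where "z = E r" using \<Lambda>_subset_X by (auto simp: X_def)
    ultimately have "5/4 \<in> J1 \<union> J2" using \<Lambda>_E(1) re_coord_E by metis
    then show False by (simp add: J1_def J2_def)
  qed
  have grow: "(4/3) ^ n * \<bar>V s - V t\<bar> \<le> \<bar>V ((b ^^ n) s) - V ((b ^^ n) t)\<bar>" for n
  proof (induction n)
    case (Suc n)
    obtain J where "J = J1 \<or> J = J2" "(b ^^ n) s \<in> J" "(b ^^ n) t \<in> J" using same by blast
    then have "4/3 * \<bar>V ((b ^^ n) s) - V ((b ^^ n) t)\<bar> \<le> \<bar>V ((b ^^ Suc n) s) - V ((b ^^ Suc n) t)\<bar>"
      using V_expansion by simp
    then show ?case using Suc by simp
  qed simp
  have bound: "(4/3) ^ n * \<bar>V s - V t\<bar> \<le> 1" for n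
    using grow[of n] V_upper[OF \<Lambda>_E(2) \<Lambda>_E(2), of "(b ^^ n) s" "(b ^^ n) t"] funpow_E E
    by (meson order_trans)
  have "V s = V t"
  proof (rule ccontr)
    assume "V s \<noteq> V t"
    then have p: "\<bar>V s - V t\<bar> > 0" by simp
    obtain n where "1 / \<bar>V s - V t\<bar> < (4/3) ^ n"
      using real_arch_pow[of "4/3"] by auto
    then have "1 < (4/3) ^ n * \<bar>V s - V t\<bar>" using p by (simp add: divide_simps)
    then show False using bound[of n] by simp
  qed
  then have "s = t" using V_lower[OF \<Lambda>_E(2)[OF E(1)] \<Lambda>_E(2)[OF E(2)]] by simp
  then show ?thesis using st by simp
qed

text \<open>A locally uniform limit of iterates would be continuous at \<open>x\<close>, so late
  iterates could not keep points converging to \<open>x\<close> a fixed distance from the orbit of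
  \<open>x\<close>.\<close>

lemma \<Lambda>_subset_Julia: "\<Lambda> \<subseteq> Julia_set \<beta>"
proof
  fix x assume x: "x \<in> \<Lambda>"
  obtain y \<delta> where y: "y \<longlonglongrightarrow> x" "\<delta> > 0" "\<And>n. dist ((\<beta> ^^ n) x) ((\<beta> ^^ n) (y n)) \<ge> \<delta>"
    using separated_sequence[OF x] by metis
  show "x \<in> Julia_set \<beta>"
  proof (rule ccontr)
    assume "x \<notin> Julia_set \<beta>"
    then obtain U where U: "open U" "x \<in> U" "normal_on U (range (\<lambda>n. \<beta> ^^ n))"
      unfolding Julia_set_def Fatou_set_def by auto
    obtain e where e: "e > 0" "cball x e \<subseteq> U" using U open_contains_cball by blast
    define K where "K = cball x e"
    have K: "compact K"
      unfolding K_def using compact_Int_closed[OF compact_UNIV_riemann_sphere closed_cball] by simp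
    obtain r g where r: "strict_mono r"
      and ul: "uniform_limit K ((\<lambda>n. \<beta> ^^ n) \<circ> r) g sequentially"
      using U(3) K e(2) unfolding normal_on_def K_def by (metis order_refl)
    \<comment> \<open>\<open>normal_on\<close> does not ask for continuous limits; it follows from
      uniform convergence.\<close>
    have cg: "continuous_on K g"
    proof (rule uniform_limit_theorem[OF _ ul])
      have "continuous_on K (\<beta> ^^ n)" for n
        by (rule continuous_on_subset[OF continuous_on_funpow[OF continuous_on_\<beta>]]) simp
      then show "\<forall>\<^sub>F n in sequentially. continuous_on K (((\<lambda>n. \<beta> ^^ n) \<circ> r) n)" by simp
    qed simp
    have yr: "(y \<circ> r) \<longlonglongrightarrow> x" using y(1) r by (rule LIMSEQ_subseq_LIMSEQ)
    have inK: "\<forall>\<^sub>F n in sequentially. (y \<circ> r) n \<in> K"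
      using tendstoD[OF yr e(1)] by eventually_elim (simp add: K_def dist_commute)
    have xK: "x \<in> K" using e by (simp add: K_def)
    have "((\<lambda>n. g ((y \<circ> r) n)) \<longlongrightarrow> g x) sequentially"
      by (rule continuous_on_tendsto_compose[OF cg yr xK inK])
    then have 1: "\<forall>\<^sub>F n in sequentially. dist (g ((y \<circ> r) n)) (g x) < \<delta> / 3"
      using y(2) by (intro tendstoD) auto
    have 2: "\<forall>\<^sub>F n in sequentially. \<forall>z\<in>K. dist ((\<beta> ^^ r n) z) (g z) < \<delta> / 3"
      using ul y(2) unfolding uniform_limit_iff by (auto dest: spec[of _ "\<delta> / 3"])
    have "\<forall>\<^sub>F n in sequentially. False"
      using 1 2 inK
    proof eventually_elim
      case (elim n)
      have "dist ((\<beta> ^^ r n) x) (g x) < \<delta> / 3"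
        "dist ((\<beta> ^^ r n) (y (r n))) (g (y (r n))) < \<delta> / 3" "dist (g (y (r n))) (g x) < \<delta> / 3"
        using elim xK by auto
      moreover have "dist ((\<beta> ^^ r n) x) ((\<beta> ^^ r n) (y (r n))) \<ge> \<delta>" by (rule y(3))
      ultimately show False by metric
    qed
    then show False by simp
  qed
qed

section \<open>The Fatou set\<close>

text \<open>
  \<open>\<Psi>\<close> is the parametrisation of the complement of \<open>X\<close> by the disc via
  \<open>S = ((1 + h) / (1 - h))\<^sup>2\<close>. It extends to the closed disc, so preimages of compact sets are compact.
\<close>

definition \<Psi> :: "complex \<Rightarrow> riemann_sphere" where
  "\<Psi> h = proj (4 - 12 * h + 4 * h\<^sup>2) (1 - 6 * h + h\<^sup>2)"

text \<open>The lift of \<open>\<beta>\<close> through \<open>\<Psi>\<close>: Cayley transform to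
  the right half plane, squaring, the map B in the coordinate S, principal root, and back to the
  disc.\<close>

definition F :: "complex \<Rightarrow> complex" where
  "F h = (let s = ((1 + h) / (1 - h))\<^sup>2; w = csqrt (28 / s + 36 / (s + 16)) in (w - 1) / (w + 1))"

lemma continuous_on_\<Psi>: "continuous_on S \<Psi>"
proof -
  have "4 - 12 * h + 4 * h\<^sup>2 \<noteq> 0 \<or> 1 - 6 * h + h\<^sup>2 \<noteq> 0" for h :: complex
  proof (rule ccontr)
    assume "\<not> ?thesis"
    then have *: "4 - 12 * h + 4 * h\<^sup>2 = 0" "1 - 6 * h + h\<^sup>2 = 0" by auto
    have "12 * h = (4 - 12 * h + 4 * h\<^sup>2) - 4 * (1 - 6 * h + h\<^sup>2)" by (simp add: algebra_simps)
    then have "h = 0" unfolding * by simp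
    then show False using * by simp
  qed
  then show ?thesis
    unfolding \<Psi>_def[abs_def] by (intro continuous_on_proj continuous_intros)
qed

text \<open>On the circle h^2 + 1 = 2 c h with c = Re h, so both quadratics are real multiples of h
  and the quotient (8 c - 12) / (2 c - 6) runs between 5/2 and 1.\<close>

lemma \<Psi>_circle:
  assumes "cmod h = 1" shows "\<Psi> h \<in> X"
proof -
  define c where "c = Re h"
  have c: "\<bar>c\<bar> \<le> 1" using assms abs_Re_le_cmod[of h] by (simp add: c_def)
  have hh: "h * cnj h = 1" using assms by (simp add: complex_norm_square[symmetric])
  have hc: "h + cnj h = of_real (2 * c)" by (simp add: complex_add_cnj c_def)
  have hn: "h \<noteq> 0" using assms by auto
  have sq: "h\<^sup>2 = h * of_real (2 * c) - 1"
    unfolding hc[symmetric] using hh by (simp add: algebra_simps power2_eq_square)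
  have "4 - 12 * h + 4 * h\<^sup>2 = h * of_real (8 * c - 12)"
    "1 - 6 * h + h\<^sup>2 = h * of_real (2 * c - 6)"
    unfolding sq by (simp_all add: algebra_simps)
  then have "\<Psi> h = proj (of_real (8 * c - 12)) (of_real (2 * c - 6))"
    unfolding \<Psi>_def by (simp only: proj_scale[OF hn])
  moreover have "complex_of_real (2 * c - 6) \<noteq> 0" using c by (auto simp only: of_real_eq_0_iff)
  ultimately have "\<Psi> h = E ((8 * c - 12) / (2 * c - 6))"
    unfolding proj_def E_def by simp
  moreover have "(8 * c - 12) / (2 * c - 6) \<in> {1..5/2}" using c by (auto simp: divide_simps)
  ultimately show ?thesis unfolding X_def by blast
qed

section \<open>Half plane, slit plane and the lift to the disc\<close>

lemma square_right_half_plane: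
  assumes "Re s > 0" shows "s\<^sup>2 \<notin> \<real>\<^sub>\<le>\<^sub>0"
proof
  assume "s\<^sup>2 \<in> \<real>\<^sub>\<le>\<^sub>0"
  then have "Im (s\<^sup>2) = 0" "Re (s\<^sup>2) \<le> 0" by (auto simp: complex_nonpos_Reals_iff)
  then have "Im s = 0" "(Re s)\<^sup>2 \<le> (Im s)\<^sup>2" using assms by (auto simp: power2_eq_square)
  then show False using assms by simp
qed

lemma Re_csqrt_pos:
  assumes "z \<notin> \<real>\<^sub>\<le>\<^sub>0" shows "Re (csqrt z) > 0"
proof (rule ccontr)
  assume "\<not> ?thesis"
  then have "Re (csqrt z) = 0" using Re_csqrt[of z] by linarith
  moreover have "(csqrt z)\<^sup>2 = z" by simp
  ultimately have "z = - of_real ((Im (csqrt z))\<^sup>2)"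
    by (metis complex_is_Real_iff complex_eq_iff minus_complex.sel power2_eq_square times_complex.sel uminus_complex.sel Re_complex_of_real Im_complex_of_real mult_zero_left diff_0 add_0 mult_zero_right neg_equal_0_iff_equal)
  then show False using assms by (metis complex_nonpos_Reals_iff Re_complex_of_real Im_complex_of_real uminus_complex.sel neg_le_0_iff_le neg_equal_0_iff_equal zero_le_power2)
qed

lemma cayley_lt_one:
  assumes "Re s > 0" shows "cmod ((s - 1) / (s + 1)) < 1"
proof -
  have "(cmod (s - 1))\<^sup>2 < (cmod (s + 1))\<^sup>2"
    using assms unfolding cmod_power2 by (simp add: power2_eq_square algebra_simps)
  then have "cmod (s - 1) < cmod (s + 1)" by (rule power_less_imp_less_base) simp
  moreover then have "0 < cmod (s + 1)" using norm_ge_zero le_less_trans by blast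
  ultimately show ?thesis by (simp add: norm_divide)
qed

lemma inverse_cayley_pos:
  assumes "cmod h < 1" shows "Re ((1 + h) / (1 - h)) > 0"
proof -
  have "(cmod h)\<^sup>2 < 1" using assms by (simp add: power_less_one_iff abs_square_less_1)
  then have "0 < (1 + Re h) * (1 - Re h) - (Im h)\<^sup>2"
    unfolding cmod_power2 by (simp add: power2_eq_square algebra_simps)
  moreover have "h \<noteq> 1" using assms by auto
  then have "0 < (1 - Re h)\<^sup>2 + (Im h)\<^sup>2"
    by (smt (verit) complex_eq_iff one_complex.sel sum_power2_gt_zero_iff)
  ultimately show ?thesis
    by (simp add: Re_divide power2_eq_square divide_simps)
qed

text \<open>The imaginary part of the value is - Im s times a positive number, so a real value needs
  real s. Off the slit such s is positive, and then so is the value.\<close>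

lemma slit_plane_invariant:
  fixes s :: complex
  assumes "s \<notin> \<real>\<^sub>\<le>\<^sub>0"
  shows "s \<noteq> 0" "s + 16 \<noteq> 0" "28 / s + 36 / (s + 16) \<notin> \<real>\<^sub>\<le>\<^sub>0"
proof -
  show s: "s \<noteq> 0" using assms by auto
  show s16: "s + 16 \<noteq> 0"
  proof
    assume "s + 16 = 0"
    then have "s = - 16" by (simp add: eq_neg_iff_add_eq_0)
    then show False using assms by simp
  qed
  let ?n = "\<lambda>z. (Re z)\<^sup>2 + (Im z)\<^sup>2"
  have n: "?n s > 0" "?n (s + 16) > 0"
    using s s16 by (metis complex_neq_0)+
  show "28 / s + 36 / (s + 16) \<notin> \<real>\<^sub>\<le>\<^sub>0"
  proof
    assume "28 / s + 36 / (s + 16) \<in> \<real>\<^sub>\<le>\<^sub>0"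
    then have I: "Im (28 / s + 36 / (s + 16)) = 0" and R: "Re (28 / s + 36 / (s + 16)) \<le> 0"
      by (auto simp: complex_nonpos_Reals_iff)
    have factor: "- (28 * i / A) - 36 * i / B = - (i * (28 / A + 36 / B))" for i A B :: real
      by (simp add: algebra_simps)
    have "Im (28 / z) = - (28 * Im z / ?n z)" "Im (36 / z) = - (36 * Im z / ?n z)" for z
      by (simp_all add: Im_divide)
    then have "Im (28 / s + 36 / (s + 16)) = - (28 * Im s / ?n s) - 36 * Im (s + 16) / ?n (s + 16)"
      by (simp only: plus_complex.sel)
    also have "\<dots> = - (28 * Im s / ?n s) - 36 * Im s / ?n (s + 16)" by simp
    also have "\<dots> = - (Im s * (28 / ?n s + 36 / ?n (s + 16)))" by (rule factor)
    finally have "Im (28 / s + 36 / (s + 16)) = - (Im s * (28 / ?n s + 36 / ?n (s + 16)))" .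
    moreover have "28 / ?n s + 36 / ?n (s + 16) > 0"
      by (intro add_pos_pos divide_pos_pos n) simp_all
    ultimately have i: "Im s = 0"
      using I by (metis less_irrefl mult_eq_0_iff neg_equal_0_iff_equal)
    then have r: "Re s > 0" using assms by (auto simp: complex_nonpos_Reals_iff)
    have "Re (28 / z) = 28 * Re z / ?n z" "Re (36 / z) = 36 * Re z / ?n z" for z
      by (simp_all add: Re_divide)
    then have "Re (28 / s + 36 / (s + 16)) = 28 * Re s / ?n s + 36 * Re (s + 16) / ?n (s + 16)"
      by (simp only: plus_complex.sel)
    moreover have "\<dots> > 0" by (intro add_pos_pos divide_pos_pos n) (use r in auto)
    ultimately show False using R by linarith
  qed
qed

lemma add_one_neq_0:
  fixes w :: complex
  assumes "Re w > 0" shows "w + 1 \<noteq> 0"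
proof
  assume "w + 1 = 0"
  then have "w = - 1" by (simp add: eq_neg_iff_add_eq_0)
  then show False using assms by simp
qed

text \<open>With S = z^2 the right side is t = (S - 5) / (S - 2), the inverse of S = (2 t - 5) / (t
  - 1).\<close>

lemma \<Psi>_cayley:
  assumes "z + 1 \<noteq> 0"
  shows "\<Psi> ((z - 1) / (z + 1)) = proj (z\<^sup>2 - 5) (z\<^sup>2 - 2)"
proof -
  let ?k = "- 4 / (z + 1)\<^sup>2"
  have "4 - 12 * ((z - 1) / (z + 1)) + 4 * ((z - 1) / (z + 1))\<^sup>2 = ?k * (z\<^sup>2 - 5)"
    "1 - 6 * ((z - 1) / (z + 1)) + ((z - 1) / (z + 1))\<^sup>2 = ?k * (z\<^sup>2 - 2)"
    using assms by (simp_all add: power_divide divide_simps) (simp_all add: algebra_simps power2_eq_square)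
  moreover have "?k \<noteq> 0" using assms by simp
  ultimately show ?thesis unfolding \<Psi>_def using proj_scale by metis
qed

text \<open>\<open>\<Psi>\<close> sees the half plane coordinate only through its square, which
  undoes \<open>csqrt\<close>. What remains is that \<open>\<beta>\<close> becomes B in the
  coordinate S.\<close>

lemma F_ball:
  assumes "h \<in> ball 0 1"
  shows "F h \<in> ball 0 1" "\<Psi> (F h) = \<beta> (\<Psi> h)"
proof -
  define \<sigma> s B w where "\<sigma> = (1 + h) / (1 - h)" and "s = \<sigma>\<^sup>2" and "B = 28 / s + 36 / (s + 16)"
    and "w = csqrt B"
  have h1: "1 - h \<noteq> 0" using assms by auto
  have s: "s \<notin> \<real>\<^sub>\<le>\<^sub>0"
    unfolding s_def \<sigma>_def using assms by (intro square_right_half_plane inverse_cayley_pos) simp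
  note sl = slit_plane_invariant[OF s]
  have w: "Re w > 0" unfolding w_def B_def by (rule Re_csqrt_pos[OF sl(3)])
  have F: "F h = (w - 1) / (w + 1)"
    by (simp only: F_def \<sigma>_def s_def B_def w_def Let_def)
  show "F h \<in> ball 0 1" using cayley_lt_one[OF w] by (simp add: F)
  have hs: "h = (\<sigma> - 1) / (\<sigma> + 1)" "\<sigma> + 1 \<noteq> 0"
    using h1 by (simp_all add: \<sigma>_def divide_simps)
  have w1: "w + 1 \<noteq> 0" using w by (rule add_one_neq_0)
  have "\<Psi> (F h) = proj (B - 5) (B - 2)"
    unfolding F \<Psi>_cayley[OF w1] by (simp add: w_def)
  moreover have "\<Psi> h = proj (s - 5) (s - 2)"
    unfolding s_def using \<Psi>_cayley[OF hs(2)] hs(1) by simp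
  moreover have "\<beta> (proj (s - 5) (s - 2)) = proj (s * (s + 16) * (B - 5)) (s * (s + 16) * (B - 2))"
  proof -
    have "s - 5 \<noteq> 0 \<or> s - 2 \<noteq> 0" by auto
    \<comment> \<open>The conjugacy with denominators cleared: s (s + 16) is the common denominator
      of B.\<close>
    moreover have "44 * (s - 5)\<^sup>2 - 76 * (s - 5) * (s - 2) + 27 * (s - 2)\<^sup>2 = s * (s + 16) * (B - 5)"
      "56 * (s - 5)\<^sup>2 - 120 * (s - 5) * (s - 2) + 62 * (s - 2)\<^sup>2 = s * (s + 16) * (B - 2)"
      unfolding B_def using sl(1,2)
      by (simp_all add: divide_simps) (simp_all add: algebra_simps power2_eq_square)
    ultimately show ?thesis by (simp only: \<beta>_proj)
  qed
  ultimately show "\<Psi> (F h) = \<beta> (\<Psi> h)" using sl by (simp add: proj_scale)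
qed

text \<open>Squares of right half plane points and their images under B stay off the slit, where
  \<open>csqrt\<close> is holomorphic.\<close>

lemma holomorphic_on_F: "F holomorphic_on ball 0 1"
proof -
  let ?B = "\<lambda>s. 28 / s + 36 / (s + 16) :: complex"
  have "?B holomorphic_on - \<real>\<^sub>\<le>\<^sub>0"
    by (intro holomorphic_intros) (auto simp: slit_plane_invariant)
  then have "(\<lambda>s. csqrt (?B s)) holomorphic_on - \<real>\<^sub>\<le>\<^sub>0"
    by (rule holomorphic_on_csqrt') (simp add: slit_plane_invariant)
  moreover have "csqrt (?B s) + 1 \<noteq> 0" if "s \<notin> \<real>\<^sub>\<le>\<^sub>0" for s
    using Re_csqrt_pos[OF slit_plane_invariant(3)[OF that]] by (rule add_one_neq_0)
  ultimately have k: "(\<lambda>s. (csqrt (?B s) - 1) / (csqrt (?B s) + 1)) holomorphic_on - \<real>\<^sub>\<le>\<^sub>0"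
    by (intro holomorphic_on_divide holomorphic_on_diff holomorphic_on_add holomorphic_on_const)
      auto
  have "(\<lambda>h. ((1 + h) / (1 - h))\<^sup>2) holomorphic_on ball (0 :: complex) 1"
    by (intro holomorphic_intros) auto
  moreover have "((1 + h) / (1 - h))\<^sup>2 \<notin> \<real>\<^sub>\<le>\<^sub>0" if "h \<in> ball 0 1" for h :: complex
    using that by (intro square_right_half_plane inverse_cayley_pos) simp
  then have "(\<lambda>h. ((1 + h) / (1 - h))\<^sup>2) ` ball (0 :: complex) 1 \<subseteq> - \<real>\<^sub>\<le>\<^sub>0" by blast
  ultimately show ?thesis
    using holomorphic_on_compose_gen[OF _ k] unfolding F_def[abs_def] Let_def o_def by blast
qed

text \<open>The preimage is the Cayley transform of the principal root of the S-coordinate of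
  \<open>x\<close>. That coordinate is off the slit because r <= 0 would give t = (r - 5) / (r - 2)
  in [1, 5/2].\<close>

lemma \<Psi>_surj:
  assumes "x \<notin> X" shows "\<exists>h\<in>ball 0 1. \<Psi> h = x"
proof -
  obtain s where s: "s \<notin> \<real>\<^sub>\<le>\<^sub>0" "proj (s - 5) (s - 2) = x"
  proof (cases x)
    case Infty
    \<comment> \<open>\<open>Infty\<close> has S-coordinate 2, the zero of S - 2.\<close>
    then show ?thesis by (intro that[of 2]) (auto simp: proj_def)
  next
    case (Fin t)
    have "E 1 \<in> X" by (simp add: X_def)
    then have t1: "t - 1 \<noteq> 0" using assms Fin by (auto simp: E_def)
    define s where "s = (2 * t - 5) / (t - 1)"
    have eq: "s - 5 = - 3 / (t - 1) * t" "s - 2 = - 3 / (t - 1) * 1"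
      using t1 by (simp_all add: s_def divide_simps)
    have "proj (s - 5) (s - 2) = Fin t"
      unfolding eq using t1 by (subst proj_scale) (auto simp: proj_def)
    moreover have "s \<notin> \<real>\<^sub>\<le>\<^sub>0"
    proof
      assume "s \<in> \<real>\<^sub>\<le>\<^sub>0"
      then obtain r where r: "s = of_real r" "r \<le> 0" by (elim nonpos_Reals_cases)
      have "r - 2 \<noteq> 0" using r(2) by simp
      then have "complex_of_real (r - 2) \<noteq> 0" by (simp only: of_real_eq_0_iff not_False_eq_True)
      then have "Fin t = E ((r - 5) / (r - 2))"
        using \<open>proj (s - 5) (s - 2) = Fin t\<close> unfolding r(1) proj_def E_def by (simp split: if_splits)
      moreover have "(r - 5) / (r - 2) \<in> {1..5/2}" using r(2) by (auto simp: divide_simps)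
      ultimately show False using assms Fin unfolding X_def by blast
    qed
    ultimately show ?thesis using that Fin by simp
  qed
  have w: "Re (csqrt s) > 0" using s(1) by (rule Re_csqrt_pos)
  have "\<Psi> ((csqrt s - 1) / (csqrt s + 1)) = x"
    using \<Psi>_cayley[OF add_one_neq_0[OF w]] s(2) by simp
  then show ?thesis using cayley_lt_one[OF w] by force
qed

section \<open>Normality outside \<open>X\<close>\<close>

lemma F_funpow:
  "(F ^^ n) holomorphic_on ball 0 1"
  "h \<in> ball 0 1 \<Longrightarrow> (F ^^ n) h \<in> ball 0 1 \<and> \<Psi> ((F ^^ n) h) = (\<beta> ^^ n) (\<Psi> h)"
proof -
  have *: "(F ^^ n) h \<in> ball 0 1 \<and> \<Psi> ((F ^^ n) h) = (\<beta> ^^ n) (\<Psi> h)" if "h \<in> ball 0 1" for n h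
    by (induction n) (use that F_ball in auto)
  then show "h \<in> ball 0 1 \<Longrightarrow> (F ^^ n) h \<in> ball 0 1 \<and> \<Psi> ((F ^^ n) h) = (\<beta> ^^ n) (\<Psi> h)" .
  show "(F ^^ n) holomorphic_on ball 0 1"
  proof (induction n)
    case (Suc n)
    have "(F ^^ n) ` ball 0 1 \<subseteq> ball 0 1" using * by blast
    then show ?case
      unfolding funpow.simps using Suc holomorphic_on_F by (intro holomorphic_on_compose_gen)
  qed (simp add: id_def)
qed

text \<open>Montel applies to the iterates of \<open>F\<close>, bounded by 1. If G is a limit along
  a subsequence, \<open>\<Psi>\<close> carries the convergence over to the iterates of
  \<open>\<beta>\<close>.\<close>

lemma Fatou_outside: "- X \<subseteq> Fatou_set \<beta>"
proof (rule Fatou_set_largest)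
  show "open (- X)" using compact_X by (simp add: compact_imp_closed open_Compl)
  show "normal_on (- X) (range (\<lambda>n. \<beta> ^^ n))"
    unfolding normal_on_def
  proof (intro allI impI)
    fix f :: "nat \<Rightarrow> riemann_sphere \<Rightarrow> riemann_sphere"
    assume "range f \<subseteq> range (\<lambda>n. \<beta> ^^ n)"
    then have "\<forall>k. \<exists>n. f k = \<beta> ^^ n" by (auto simp: image_subset_iff)
    then obtain m where m: "\<And>k. f k = \<beta> ^^ m k" by metis
    obtain G r where r: "strict_mono (r :: nat \<Rightarrow> nat)"
      and ptw: "\<And>h. h \<in> ball 0 1 \<Longrightarrow> (\<lambda>n. (F ^^ m (r n)) h) \<longlonglongrightarrow> G h"
      and ul: "\<And>K. compact K \<Longrightarrow> K \<subseteq> ball 0 1 \<Longrightarrow> uniform_limit K ((\<lambda>k. F ^^ m k) \<circ> r) G sequentially"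
    proof (rule Montel[of "ball 0 1" "range (\<lambda>n. F ^^ n)" "\<lambda>k. F ^^ m k"])
      fix K :: "complex set" assume "compact K" "K \<subseteq> ball 0 1"
      then have "cmod ((F ^^ n) z) \<le> 1" if "z \<in> K" for n z
        using F_funpow(2)[of z n] that by auto
      then show "\<exists>B. \<forall>h\<in>range (\<lambda>n. F ^^ n). \<forall>z\<in>K. cmod (h z) \<le> B" by blast
    qed (use F_funpow(1) in auto)
    \<comment> \<open>An arbitrary section of \<open>\<Psi>\<close> over the complement of
      \<open>X\<close>.\<close>
    define \<kappa> where "\<kappa> x = (SOME h. h \<in> ball 0 1 \<and> \<Psi> h = x)" for x
    have \<kappa>: "\<kappa> x \<in> ball 0 1" "\<Psi> (\<kappa> x) = x" if "x \<in> - X" for x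
    proof -
      have "\<exists>h. h \<in> ball 0 1 \<and> \<Psi> h = x" using \<Psi>_surj[of x] that by blast
      from someI_ex[OF this] show "\<kappa> x \<in> ball 0 1" "\<Psi> (\<kappa> x) = x" unfolding \<kappa>_def by blast+
    qed
    have "uniformly_continuous_on (cball 0 1) \<Psi>"
      by (intro compact_uniformly_continuous continuous_on_\<Psi>) simp
    then have uc: "\<exists>d>0. \<forall>u\<in>cball 0 1. \<forall>v\<in>cball 0 1. dist u v < d \<longrightarrow> dist (\<Psi> u) (\<Psi> v) < e"
      if "e > 0" for e
      using that unfolding uniformly_continuous_on_def by (metis dist_commute)
    have "uniform_limit K (f \<circ> r) (\<lambda>x. \<Psi> (G (\<kappa> x))) sequentially" if K: "compact K" "K \<subseteq> - X" for K
    proof -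
      \<comment> \<open>Compact as a closed part of the closed disc; \<open>\<Psi>_circle\<close>
        keeps it off the boundary circle.\<close>
      define K' where "K' = cball 0 1 \<inter> \<Psi> -` K"
      have "closed K'"
        unfolding K'_def
        by (intro continuous_closed_preimage continuous_on_\<Psi> compact_imp_closed K closed_cball)
      then have "compact K'"
        using compact_Int_closed[of "cball 0 1" K'] by (simp add: K'_def Int_absorb1 inf_assoc[symmetric])
      moreover have sub: "K' \<subseteq> ball 0 1"
      proof
        fix h assume h: "h \<in> K'"
        then have "\<Psi> h \<notin> X" using K by (auto simp: K'_def)
        then have "cmod h \<noteq> 1" using \<Psi>_circle by blast
        then show "h \<in> ball 0 1" using h by (auto simp: K'_def)
      qed
      ultimately have ulK: "uniform_limit K' ((\<lambda>k. F ^^ m k) \<circ> r) G sequentially" by (rule ul)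
      \<comment> \<open>The limit may touch the circle, so uniform continuity of
        \<open>\<Psi>\<close> is taken on the closed disc.\<close>
      have Gb: "G h \<in> cball 0 1" if "h \<in> ball 0 1" for h
      proof (rule Lim_in_closed_set[OF closed_cball _ _ ptw[OF that]])
        show "\<forall>\<^sub>F n in sequentially. (F ^^ m (r n)) h \<in> cball 0 1"
          using F_funpow(2)[OF that] by (intro always_eventually allI) (meson ball_subset_cball subsetD)
      qed simp
      show ?thesis
        unfolding uniform_limit_iff
      proof (intro allI impI)
        fix e :: real assume "e > 0"
        then obtain d where d: "d > 0"
          "\<And>u v. u \<in> cball 0 1 \<Longrightarrow> v \<in> cball 0 1 \<Longrightarrow> dist u v < d \<Longrightarrow> dist (\<Psi> u) (\<Psi> v) < e"
          using uc by metis
        have "\<forall>\<^sub>F n in sequentially. \<forall>h\<in>K'. dist ((F ^^ m (r n)) h) (G h) < d"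
          using ulK d(1) unfolding uniform_limit_iff by simp
        then show "\<forall>\<^sub>F n in sequentially. \<forall>x\<in>K. dist ((f \<circ> r) n x) (\<Psi> (G (\<kappa> x))) < e"
        proof eventually_elim
          case (elim n)
          show ?case
          proof
            fix x assume x: "x \<in> K"
            then have k: "\<kappa> x \<in> ball 0 1" "\<Psi> (\<kappa> x) = x" using \<kappa> K by blast+
            then have "\<kappa> x \<in> K'" using x by (auto simp: K'_def)
            then have "dist ((F ^^ m (r n)) (\<kappa> x)) (G (\<kappa> x)) < d" using elim by blast
            moreover have "(F ^^ m (r n)) (\<kappa> x) \<in> cball 0 1"
              "\<Psi> ((F ^^ m (r n)) (\<kappa> x)) = (\<beta> ^^ m (r n)) x"
              using F_funpow(2)[OF k(1), of "m (r n)"] k(2) ball_subset_cball by auto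
            ultimately show "dist ((f \<circ> r) n x) (\<Psi> (G (\<kappa> x))) < e"
              using d(2) Gb[OF k(1)] m by fastforce
          qed
        qed
      qed
    qed
    then show "\<exists>r g. strict_mono r \<and>
        (\<forall>K. compact K \<and> K \<subseteq> - X \<longrightarrow> uniform_limit K (f \<circ> r) g sequentially)"
      using r by blast
  qed
qed

text \<open>Precomposing with \<open>f\<close> carries normality back to the preimage, since every
  iterate but the zeroth factors through \<open>f\<close>.\<close>

lemma Fatou_backward:
  assumes f: "continuous_on UNIV f" and x: "f x \<in> Fatou_set f"
  shows "x \<in> Fatou_set f"
proof -
  let ?U = "f -` Fatou_set f"
  have op: "open ?U"
    using f Fatou_set_largest(1) by (simp add: continuous_on_open_vimage)
  have "normal_on ?U (range (\<lambda>n. f ^^ n))"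
    unfolding normal_on_def
  proof (intro allI impI)
    fix h :: "nat \<Rightarrow> riemann_sphere \<Rightarrow> riemann_sphere"
    assume "range h \<subseteq> range (\<lambda>n. f ^^ n)"
    then have "\<forall>k. \<exists>n. h k = f ^^ n" by (auto simp: image_subset_iff)
    then obtain m where m: "\<And>k. h k = f ^^ m k" by metis
    show "\<exists>r g. strict_mono r \<and>
        (\<forall>K. compact K \<and> K \<subseteq> ?U \<longrightarrow> uniform_limit K (h \<circ> r) g sequentially)"
    \<comment> \<open>If the identity recurs infinitely often, it is a constant subsequence.
      Otherwise N initial terms are dropped and one \<open>f\<close> is split off each
      exponent.\<close>
    proof (cases "infinite {k. m k = 0}")
      case True
      define r where "r = enumerate {k. m k = 0}"
      have "strict_mono r" unfolding r_def by (rule strict_mono_enumerate[OF True])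
      moreover have "h (r n) = id" for n
        using enumerate_in_set[OF True, of n] m[of "r n"] by (simp add: r_def)
      ultimately show ?thesis
        by (intro exI[of _ r] exI[of _ id]) (auto simp: uniform_limit_iff)
    next
      case False
      then obtain N where N: "\<And>k. k \<ge> N \<Longrightarrow> m k \<noteq> 0"
        by (metis (mono_tags, lifting) finite_nat_set_iff_bounded mem_Collect_eq not_less)
      have "range (\<lambda>k. f ^^ (m (k + N) - 1)) \<subseteq> range (\<lambda>n. f ^^ n)" by auto
      then obtain r g where r: "strict_mono (r :: nat \<Rightarrow> nat)"
        and ul: "\<And>K. compact K \<Longrightarrow> K \<subseteq> Fatou_set f \<Longrightarrow>
            uniform_limit K ((\<lambda>k. f ^^ (m (k + N) - 1)) \<circ> r) g sequentially"
        using Fatou_set_largest(2)[of f] unfolding normal_on_def by metis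
      have "uniform_limit K (h \<circ> (\<lambda>n. r n + N)) (g \<circ> f) sequentially"
        if K: "compact K" "K \<subseteq> ?U" for K
      proof -
        have "compact (f ` K)"
          using f K(1) by (intro compact_continuous_image continuous_on_subset[OF f]) auto
        moreover have "f ` K \<subseteq> Fatou_set f" using K(2) by auto
        ultimately have "uniform_limit (f ` K) ((\<lambda>k. f ^^ (m (k + N) - 1)) \<circ> r) g sequentially"
          by (rule ul)
        moreover have "h (r n + N) z = (f ^^ (m (r n + N) - 1)) (f z)" for n z
        proof -
          have "m (r n + N) = Suc (m (r n + N) - 1)" using N[of "r n + N"] by simp
          then show ?thesis by (metis m comp_apply funpow_Suc_right)
        qed
        ultimately show ?thesis unfolding uniform_limit_iff by simp
      qed
      moreover have "strict_mono (\<lambda>n. r n + N)" using r by (simp add: strict_mono_def)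
      ultimately show ?thesis by blast
    qed
  qed
  then have "?U \<subseteq> Fatou_set f" using op by (rule Fatou_set_largest(3)[rotated])
  then show ?thesis using x by auto
qed

text \<open>By \<open>Fatou_backward\<close> the Julia set is forward invariant. As it lies in
  \<open>X\<close>, its orbits stay in \<open>X\<close>.\<close>

lemma Julia_eq: "Julia_set \<beta> = \<Lambda>"
proof
  show "Julia_set \<beta> \<subseteq> \<Lambda>"
  proof
    fix x assume x: "x \<in> Julia_set \<beta>"
    have "(\<beta> ^^ n) x \<in> Julia_set \<beta>" for n
      by (induction n) (use x Fatou_backward[OF continuous_on_\<beta>] in \<open>auto simp: Julia_set_def\<close>)
    then show "x \<in> \<Lambda>" using Fatou_outside unfolding \<Lambda>_def Julia_set_def by blast
  qed
qed (rule \<Lambda>_subset_Julia)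

theorem mainTheorem10:
  shows "Cantor_space (top_of_set (Julia_set \<beta>)) \<and> Julia_set \<beta> \<subseteq> Fin ` \<real>"
proof
  have "compact \<Lambda>"
    using compact_Int_closed[OF compact_UNIV_riemann_sphere closed_\<Lambda>] by simp
  \<comment> \<open>The derived set in the subspace is cut down to \<open>\<Lambda>\<close>, and
    \<open>islimpt_\<Lambda>\<close> supplies every point.\<close>
  moreover have "top_of_set \<Lambda> derived_set_of \<Lambda> = \<Lambda>"
    using islimpt_\<Lambda> unfolding derived_set_of_subtopology
    by (auto simp: in_derived_set_of islimpt_def) metis
  ultimately show "Cantor_space (top_of_set (Julia_set \<beta>))"
    unfolding Julia_eq Cantor_space_def
    using two_cycle_in_\<Lambda> connected_\<Lambda>_subset
    by (auto simp: connectedin_subtopology metrizable_space_subtopology metrizable_space_euclidean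
        intro!: compact_space_subtopology) blast
  show "Julia_set \<beta> \<subseteq> Fin ` \<real>"
    unfolding Julia_eq using \<Lambda>_subset_X by (auto simp: X_def E_def)
qed

end
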